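(* Let $c$ be a real number with $0<c<0.5042$, and let $\delta\in(0,1)$ be fixed. For $T\ge 2$ put $y=T^{1-\delta}$ and $$g(n)=\frac{2\sin\left(\frac{\pi c\log n}{\log T}\right)}{\pi\log n}\qquad (n\ge 2).$$ For a sequence of complex numbers $(a_k)_{k\ge1}$ with $a_k\neq 0$ for at least one $k\le y$, define $$h(c)=c-\frac{\Re\displaystyle\sum_{kn\le y} a_k\,\overline{a_{kn}}\,g(n)\frac{\Lambda(n)}{n^{1/2}}}{\displaystyle\sum_{k\le y}|a_k|^2},$$ where the sum in the numerator runs over pairs of positive integers $k,n$ with $kn\le y$ and $\Lambda$ is the von Mangoldt function (so only $n\ge 2$ contribute). Then for all sufficiently large $T$ (depending only on $c$ and $\delta$) and every such choice of the sequence $(a_k)$, one has $h(c)<1$.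
   Context: $\Lambda(n)$ denotes the von Mangoldt function: $\Lambda(n)=\log p$ if $n=p^m$ is a power of a prime $p$ with $m\ge1$, and $\Lambda(n)=0$ otherwise. The quantity $h(c)$ is the one appearing in the Montgomery--Odlyzko method for small gaps between zeros of the Riemann zeta-function (where $h(c)>1$ for all large $T$ would imply, under the Riemann Hypothesis, that $\liminf_{n\to\infty}(\gamma_{n+1}-\gamma_n)/(2\pi/\log\gamma_n)\le c$); the theorem says this cannot happen for $c<0.5042$. *)

theory Defs
  imports Complex_Main "HOL-Number_Theory.Prime_Powers"
begin

definition mo_y :: "real \<Rightarrow> real \<Rightarrow> real" where
  "mo_y \<delta> T = T powr (1 - \<delta>)"

definition mo_g :: "real \<Rightarrow> real \<Rightarrow> nat \<Rightarrow> real" where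
  "mo_g c T n = 2 * sin (pi * c * ln (real n) / ln T) / (pi * ln (real n))"

(* A sequence (a_k), k \<ge> 1, is a function on nat whose value at 0 is never used.
   Pairs with n = 1 contribute nothing since mangoldt 1 = 0. *)
definition mo_h :: "real \<Rightarrow> real \<Rightarrow> (nat \<Rightarrow> complex) \<Rightarrow> real \<Rightarrow> real" where
  "mo_h \<delta> T a c =
     c - Re (\<Sum>(k, n) | k \<ge> 1 \<and> n \<ge> 1 \<and> real (k * n) \<le> mo_y \<delta> T.
               a k * cnj (a (k * n)) * complex_of_real (mo_g c T n * (mangoldt n / sqrt (real n))))
         / (\<Sum>k | k \<ge> 1 \<and> real k \<le> mo_y \<delta> T. (cmod (a k))\<^sup>2)"

end

theory Submission
  imports Defs "HOL-Analysis.Complex_Transcendental"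
begin

text \<open>Schur's test for the quadratic form. Write \<open>g(n) = 2 c q / ln T\<close> with
  \<open>q = sin (\<pi> c u) / (\<pi> c u)\<close> and \<open>u = ln n / ln T\<close>. By AM-GM,
  \<open>2 |a\<^sub>k a\<^sub>k\<^sub>n| q / sqrt n \<le> r q\<^sup>2 |a\<^sub>k|\<^sup>2 / n + |a\<^sub>k\<^sub>n|\<^sup>2 / r\<close> for every \<open>r > 0\<close>. Summed
  against \<open>\<Lambda>(n)\<close>, the last term gives \<open>ln m / r\<close> for each \<open>m = kn\<close>, whereas by Mertens and
  partial summation the first gives \<open>r \<integral> q\<^sup>2 du\<close>, taken over \<open>0 \<le> u \<le> ln (y/k) / ln T\<close>
  and multiplied by \<open>ln T\<close>. With \<open>q \<le> 1\<close> and \<open>r = 1\<close> this yields \<open>c \<le> 1/2\<close>; for larger \<open>c\<close>, the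
  decay \<open>q\<^sup>2 \<le> 1 - 0.57 u\<^sup>2\<close> leaves room for \<open>r = 1.1\<close>.\<close>

section \<open>Upper bounds of Chebyshev and Mertens\<close>

text \<open>From \<open>N\<close> to \<open>Suc N\<close> the quotient by \<open>d\<close> grows by
  one exactly when \<open>d\<close> divides \<open>Suc N\<close>, and \<open>mangoldt\<close> summed
  over these divisors is \<open>ln (Suc N)\<close>.\<close>

lemma ln_fact_conv_mangoldt:
  "ln (fact N :: real) = (\<Sum>d=1..N. mangoldt d * real (N div d))"
proof (induction N)
  case 0
  then show ?case by simp
next
  case (Suc N)
  have div: "real (Suc N div d) = real (N div d) + (if d dvd Suc N then 1 else 0)" for d
    by (auto simp: div_Suc mod_eq_0_iff_dvd)
  have "(\<Sum>d=1..Suc N. mangoldt d * real (Suc N div d)) =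
      (\<Sum>d=1..Suc N. mangoldt d * real (N div d)) +
      (\<Sum>d=1..Suc N. if d dvd Suc N then mangoldt d else 0)"
    unfolding div sum.distrib[symmetric] by (intro sum.cong) (auto simp: algebra_simps)
  also have "(\<Sum>d=1..Suc N. mangoldt d * real (N div d)) = ln (fact N)"
    using Suc.IH by simp
  also have "(\<Sum>d=1..Suc N. if d dvd Suc N then mangoldt d else (0::real)) =
      (\<Sum>d | d dvd Suc N. mangoldt d)"
    by (subst sum.inter_filter[symmetric])
       (auto intro!: sum.cong dest: dvd_imp_le intro: Suc_leI[OF dvd_pos_nat])
  also have "\<dots> = ln (real (Suc N))"
    using mangoldt_sum[of "Suc N", where ?'a = real] by simp
  finally show ?case
    by (simp add: ln_mult add.commute)
qed

lemma ln_central_binomial_le: "ln (fact (2 * n) :: real) - 2 * ln (fact n) \<le> 2 * real n"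
proof -
  have "fact n * fact n * real ((2 * n) choose n) = fact (2 * n)"
    using binomial_fact_lemma[of n "2 * n"]
    by (metis (mono_tags, lifting) add_diff_cancel_left' le_add1 mult_2 of_nat_fact of_nat_mult)
  then have "ln (fact (2 * n) :: real) = 2 * ln (fact n) + ln (real ((2 * n) choose n))"
    by (metis (no_types, opaque_lifting) fact_nonzero ln_mult mult_2 mult_eq_0_iff)
  moreover have "real ((2 * n) choose n) \<le> 2 ^ (2 * n)"
    using binomial_le_pow2[of "2 * n" n] of_nat_mono by fastforce
  then have "ln (real ((2 * n) choose n)) \<le> ln (2 ^ (2 * n))"
    by (subst ln_le_cancel_iff) auto
  moreover have "ln (2 ^ (2 * n)) \<le> 2 * real n"
    using ln_2_less_1 by (simp add: ln_realpow mult_left_le)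
  ultimately show ?thesis by linarith
qed

text \<open>Chebyshev's argument: the logarithm of the central binomial coefficient weights
  \<open>mangoldt d\<close> by a nonnegative integer, which is at least 1 for n < d \<le>
  2n.\<close>

lemma chebyshev_psi_double:
  "(\<Sum>d=1..2*n. mangoldt d) \<le> (\<Sum>d=1..n. mangoldt d) + 2 * real n"
proof -
  have "(\<Sum>d=1..n. mangoldt d * real (n div d)) = (\<Sum>d=1..2*n. mangoldt d * real (n div d))"
    by (intro sum.mono_neutral_left) auto
  then have eq: "ln (fact (2 * n)) - 2 * ln (fact n) =
      (\<Sum>d=1..2*n. mangoldt d * (real (2 * n div d) - 2 * real (n div d)))"
    by (simp add: ln_fact_conv_mangoldt sum_subtractf right_diff_distrib sum_distrib_left mult.left_commute)
  have ge: "real (2 * n div d) - 2 * real (n div d) \<ge> (if d \<in> {n+1..2*n} then 1 else 0)" for d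
  proof -
    have "2 * (n div d) \<le> 2 * n div d"
      by (cases "d = 0") (simp_all add: less_eq_div_iff_mult_less_eq)
    moreover have "2 * n div d \<ge> 1 \<and> n div d = 0" if "d \<in> {n+1..2*n}"
      using that div_greater_zero_iff[of "2 * n" d] by auto
    ultimately show ?thesis by (auto split: if_splits)
  qed
  have "(\<Sum>d=1..2*n. mangoldt d) - (\<Sum>d=1..n. mangoldt d) = (\<Sum>d=n+1..2*n. mangoldt d :: real)"
    using sum.ub_add_nat[of 1 n "mangoldt :: nat \<Rightarrow> real" n] by (simp add: mult_2)
  also have "\<dots> = (\<Sum>d=1..2*n. mangoldt d * (if d \<in> {n+1..2*n} then 1 else 0))"
    by (intro sum.mono_neutral_cong_left) auto
  also have "\<dots> \<le> (\<Sum>d=1..2*n. mangoldt d * (real (2 * n div d) - 2 * real (n div d)))"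
    by (intro sum_mono mult_left_mono ge mangoldt_nonneg)
  also have "\<dots> \<le> 2 * real n"
    unfolding eq[symmetric] by (rule ln_central_binomial_le)
  finally show ?thesis by simp
qed

text \<open>Halving gives 4m + 2m for n = 2m; the constant 4 leaves room for the extra term
  \<open>mangoldt n\<close>, at most n, when n is odd.\<close>

lemma chebyshev_psi_le: "(\<Sum>d=1..n. mangoldt d) \<le> 4 * real n"
proof (induction n rule: less_induct)
  case (less n)
  define m where "m = n div 2"
  consider "n = 0" | "n = 2 * m" "0 < n" | "n = Suc (2 * m)"
    unfolding m_def by (cases "even n") auto
  then show ?case
  proof cases
    case 2
    then show ?thesis
      using less.IH[of m] chebyshev_psi_double[of m] by simp
  next
    case 3
    have "mangoldt n \<le> real n"
      using mangoldt_le[of n] ln_le_minus_one[of "real n"] 3 by linarith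
    then show ?thesis
      using less.IH[of m] chebyshev_psi_double[of m] 3 by simp
  qed simp
qed

text \<open>Divide ln N! \<le> N ln N by N. Dropping the floor in N / n costs at most the Chebyshev
  sum, hence the 4.\<close>

lemma mertens_upper:
  assumes "N \<ge> 1"
  shows "(\<Sum>n=1..N. mangoldt n / real n) \<le> ln (real N) + 4"
proof -
  have fl: "real N / real n - 1 \<le> real (N div n)" if "n \<ge> 1" for n
  proof -
    have "real (N div n) = of_int \<lfloor>real N / real n\<rfloor>"
      by (simp add: floor_divide_of_nat_eq)
    then show ?thesis by linarith
  qed
  have "(\<Sum>n=1..N. mangoldt n * (real N / real n - 1)) \<le> (\<Sum>n=1..N. mangoldt n * real (N div n))"
    by (intro sum_mono mult_left_mono fl mangoldt_nonneg) auto
  also have "\<dots> = ln (fact N)"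
    by (rule ln_fact_conv_mangoldt[symmetric])
  also have "\<dots> \<le> ln (real N ^ N)"
    using assms fact_le_power[of N, where ?'a = real] by (subst ln_le_cancel_iff) auto
  also have "\<dots> = real N * ln (real N)"
    using assms by (simp add: ln_realpow)
  finally have "real N * (\<Sum>n=1..N. mangoldt n / real n) - (\<Sum>n=1..N. mangoldt n) \<le> real N * ln (real N)"
    by (simp add: right_diff_distrib sum_subtractf sum_distrib_left mult.commute)
  then have "real N * (\<Sum>n=1..N. mangoldt n / real n) \<le> real N * (ln (real N) + 4)"
    using chebyshev_psi_le[of N] by (simp add: algebra_simps)
  then show ?thesis
    using assms by simp
qed

text \<open>Partial summation, with \<open>F\<close> the antiderivative of the weight 1 - \<kappa>
  u^2. As the weight decreases from 1 and stays nonnegative, the Mertens error 4 is not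
  enlarged.\<close>

lemma weighted_mertens_upper:
  fixes \<kappa> L :: real
  assumes "0 \<le> \<kappa>" "\<kappa> \<le> 1" "0 < L" "1 \<le> M" "ln (real M) \<le> L"
  defines "p \<equiv> \<lambda>n. 1 - \<kappa> * (ln (real n) / L)\<^sup>2"
  defines "F \<equiv> \<lambda>u. u - \<kappa> * u ^ 3 / 3"
  shows "(\<Sum>n=1..M. mangoldt n / real n * p n) \<le> L * F (ln (real M) / L) + 4"
proof -
  define B where "B = (\<lambda>n. \<Sum>i=1..n. mangoldt i / real i :: real)"
  \<comment> \<open>With the boundary term of partial summation removed, each increment is a
    nonpositive Mertens error plus a term of a Riemann sum; the start is
    \<open>E 1 = 4\<close>.\<close>
  define E where "E = (\<lambda>n. (\<Sum>i=1..n. mangoldt i / real i * p i) - p n * (B n - ln (real n) - 4))"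
  have p_nonneg: "p n \<ge> 0" if "1 \<le> n" "n \<le> M" for n
  proof -
    have "0 \<le> ln (real n) / L"
      using that assms by simp
    moreover have "ln (real n) / L \<le> 1"
      using that assms by (simp add: order_trans[OF _ assms(5)])
    ultimately have "(ln (real n) / L)\<^sup>2 \<le> 1"
      by (simp add: power_le_one)
    then have "\<kappa> * (ln (real n) / L)\<^sup>2 \<le> 1 * 1"
      using assms by (intro mult_mono) auto
    then show ?thesis by (simp add: p_def)
  qed
  have E_le: "E M \<le> L * F (ln (real M) / L) + 4"
    using \<open>1 \<le> M\<close> order_refl[of M]
  proof (induction M rule: dec_induct)
    case base
    show ?case by (simp add: E_def B_def p_def F_def)
  next
    case (step n)
    define u where "u = ln (real n) / L"
    define v where "v = ln (real (Suc n)) / L"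
    have uv: "0 \<le> u" "u \<le> v"
      using step assms by (auto simp: u_def v_def divide_right_mono)
    have "E (Suc n) = E n + (p n - p (Suc n)) * (B n - ln (real n) - 4)
        + p (Suc n) * (ln (real (Suc n)) - ln (real n))"
      by (simp add: E_def B_def algebra_simps)
    also have "(p n - p (Suc n)) * (B n - ln (real n) - 4) \<le> 0"
    proof (rule mult_nonneg_nonpos)
      have "u\<^sup>2 \<le> v\<^sup>2"
        using uv by (intro power_mono)
      then show "0 \<le> p n - p (Suc n)"
        using assms(1) by (simp add: p_def u_def v_def mult_left_mono)
      show "B n - ln (real n) - 4 \<le> 0"
        using mertens_upper[of n] step by (simp add: B_def)
    qed
    also have "p (Suc n) * (ln (real (Suc n)) - ln (real n)) = L * ((1 - \<kappa> * v\<^sup>2) * (v - u))"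
      using assms by (simp add: p_def u_def v_def field_simps)
    \<comment> \<open>A decreasing weight taken at the right endpoint gives a lower Riemann sum; the
      factorization below proves this algebraically.\<close>
    also have "(1 - \<kappa> * v\<^sup>2) * (v - u) \<le> F v - F u"
    proof -
      have "3 * v\<^sup>2 * (v - u) - (v ^ 3 - u ^ 3) = (v - u)\<^sup>2 * (2 * v + u)"
        by (simp add: power2_eq_square power3_eq_cube algebra_simps)
      moreover have "\<dots> \<ge> 0"
        using uv by simp
      ultimately have "\<kappa> * (v ^ 3 - u ^ 3) \<le> \<kappa> * (3 * v\<^sup>2 * (v - u))"
        using assms by (intro mult_left_mono) auto
      then show ?thesis by (simp add: F_def algebra_simps)
    qed
    finally show ?case
      using step assms by (simp add: u_def v_def algebra_simps)
  qed
  have "p M * (B M - ln (real M) - 4) \<le> 0"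
    using mertens_upper[of M] p_nonneg[of M] assms(4) by (intro mult_nonneg_nonpos) (auto simp: B_def)
  then show ?thesis
    using E_le by (simp add: E_def)
qed

section \<open>The quadratic form\<close>

lemma sin_over_id_le:
  fixes s :: real
  assumes "0 < s"
  shows "sin s / s \<le> 1 - s\<^sup>2 / 6 + s ^ 4 / 120"
proof -
  have "\<bar>sin s - (s - s ^ 3 / 6)\<bar> \<le> s ^ 5 / 120"
    using Maclaurin_sin_bound[of s 5] assms
    by (simp add: sin_coeff_Suc cos_coeff_Suc eval_nat_numeral divide_simps)
  then have "sin s \<le> s - s ^ 3 / 6 + s ^ 5 / 120"
    by linarith
  then have "sin s \<le> s * (1 - s\<^sup>2 / 6 + s ^ 4 / 120)"
    by (simp add: algebra_simps eval_nat_numeral)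
  then show ?thesis
    using assms by (simp add: pos_divide_le_eq mult.commute)
qed

text \<open>With z = s^2 \<le> 2.51, each z^2 is absorbed into a multiple of z: 1/6 - 2.51/120 >
  0.1457, then 0.2914 - 2.51 * 0.1457^2 > 0.235. The lower bound on c gives z \<ge> 2.46 u^2, and
  0.235 * 2.46 > 0.57.\<close>

lemma sinc_square_le:
  fixes c u :: real
  assumes "1/2 \<le> c" "c \<le> 0.5042" "0 < u" "u \<le> 1"
  shows "(sin (pi * c * u) / (pi * c * u))\<^sup>2 \<le> 1 - 0.57 * u\<^sup>2"
proof -
  define s where "s = pi * c * u"
  define z where "z = s\<^sup>2"
  have "pi * c \<ge> 1.57"
    using mult_mono[of "3.14" pi "1/2" c] assms pi_approx by simp
  moreover have "pi * c \<le> 1.584"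
    using mult_mono[of pi "3.1415927" c "0.5042"] assms pi_approx by simp
  ultimately have s: "1.57 * u \<le> s" "s \<le> 1.584" "0 < s"
    using assms mult_right_mono[of "1.57" "pi * c" u] mult_mono[of "pi * c" "1.584" u 1]
    by (auto simp: s_def)
  have "(1.57 * u)\<^sup>2 \<le> z" "z \<le> 1.584\<^sup>2"
    unfolding z_def using s assms by (auto intro!: power_mono)
  then have z: "2.46 * u\<^sup>2 \<le> z" "z \<le> 2.51" "0 \<le> z"
    using zero_le_power2[of u] unfolding power_mult_distrib
    by (simp_all add: z_def power_divide)
       (use zero_le_power2[of u] in linarith)
  have "sin s / s \<le> 1 - z / 6 + z\<^sup>2 / 120"
    using sin_over_id_le[OF s(3)] by (simp add: z_def)
  also have "z\<^sup>2 \<le> 2.51 * z"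
    using z mult_right_mono[of z "2.51" z] by (simp add: power2_eq_square)
  finally have q: "sin s / s \<le> 1 - 0.1457 * z"
    using z by simp
  have "sin s > 0"
    using s pi_approx by (intro sin_gt_zero) auto
  then have "(sin s / s)\<^sup>2 \<le> (1 - 0.1457 * z)\<^sup>2"
    using q s by (intro power_mono) auto
  also have "\<dots> = 1 - 0.2914 * z + 0.1457\<^sup>2 * z\<^sup>2"
    by (simp add: power2_eq_square algebra_simps)
  also have "\<dots> \<le> 1 - 0.235 * z"
    using \<open>z\<^sup>2 \<le> 2.51 * z\<close> z by (simp add: power2_eq_square)
  also have "\<dots> \<le> 1 - 0.57 * u\<^sup>2"
    using z(1) by simp (use zero_le_power2[of u] in linarith)
  finally show ?thesis by (simp add: s_def)
qed

lemma sinc_square_le_one: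
  fixes s :: real
  assumes "0 < s"
  shows "(sin s / s)\<^sup>2 \<le> 1"
proof -
  have "\<bar>sin s\<bar> \<le> \<bar>s\<bar>"
    by (rule abs_sin_x_le_abs_x)
  then show ?thesis
    using assms by (simp add: abs_square_le_1)
qed

section \<open>Regrouping sums over pairs, and Schur's test\<close>

lemma sum_pairs_first:
  fixes f g :: "nat \<Rightarrow> real"
  shows "(\<Sum>(k, n) | k \<ge> 1 \<and> n \<ge> 1 \<and> k * n \<le> N. f k * g n) = (\<Sum>k=1..N. f k * (\<Sum>n=1..N div k. g n))"
proof -
  have "{(k, n). k \<ge> 1 \<and> n \<ge> 1 \<and> k * n \<le> N} = (SIGMA k:{1..N}. {1..N div k})"
  proof -
    have le: "k \<le> N" if "n > 0" "k * n \<le> N" for k n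
      using that by (cases n) auto
    have "n \<le> N div k \<longleftrightarrow> k * n \<le> N" if "k > 0" for k n
      using that by (simp add: less_eq_div_iff_mult_less_eq mult.commute)
    then show ?thesis
      by (auto simp: Suc_le_eq intro: le)
  qed
  then show ?thesis
    by (simp add: sum.Sigma sum_distrib_left)
qed

text \<open>Group the pairs by m = kn: then n runs over the divisors of m, and the divisor sum of
  \<open>mangoldt\<close> is ln m.\<close>

lemma sum_pairs_product:
  fixes f :: "nat \<Rightarrow> real"
  shows "(\<Sum>(k, n) | k \<ge> 1 \<and> n \<ge> 1 \<and> k * n \<le> N. mangoldt n * f (k * n)) = (\<Sum>m=1..N. f m * ln (real m))"
proof -
  have "(\<Sum>(k, n) | k \<ge> 1 \<and> n \<ge> 1 \<and> k * n \<le> N. mangoldt n * f (k * n)) =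
      (\<Sum>(m, n)\<in>(SIGMA m:{1..N}. {n. n dvd m}). mangoldt n * f m)"
    by (rule sum.reindex_bij_witness[where i = "\<lambda>(m, n). (m div n, n)" and j = "\<lambda>(k, n). (k * n, n)"])
       (auto simp: Suc_le_eq intro!: Nat.gr0I)
  also have "\<dots> = (\<Sum>m=1..N. \<Sum>n | n dvd m. mangoldt n * f m)"
    by (subst sum.Sigma) auto
  also have "\<dots> = (\<Sum>m=1..N. f m * ln (real m))"
    by (intro sum.cong refl) (simp add: sum_distrib_right[symmetric] mangoldt_sum)
  finally show ?thesis .
qed

text \<open>In \<open>balance\<close>, \<open>x\<close> stands for \<open>ln (y / k) / ln T\<close>, with \<open>\<delta>\<close> replaced by 0; the discarded term
  \<open>c * \<delta> / r\<close> absorbs the errors of order \<open>1 / ln T\<close>.\<close>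

lemma mo_h_less_one_criterion:
  fixes c \<delta> r \<kappa> :: real
  assumes c: "0 < c" and \<delta>: "0 < \<delta>" "\<delta> < 1" and r: "0 < r" and \<kappa>: "0 \<le> \<kappa>" "\<kappa> \<le> 1"
    and sinc: "\<And>u. 0 < u \<Longrightarrow> u \<le> 1 \<Longrightarrow> (sin (pi * c * u) / (pi * c * u))\<^sup>2 \<le> 1 - \<kappa> * u\<^sup>2"
    and balance: "\<And>x. 0 \<le> x \<Longrightarrow> x \<le> 1 \<Longrightarrow> c + c * (r * (x - \<kappa> * x ^ 3 / 3) + (1 - x) / r) \<le> 1"
  shows "\<exists>T\<^sub>0\<ge>2. \<forall>T\<ge>T\<^sub>0. \<forall>a :: nat \<Rightarrow> complex.
           (\<exists>k\<ge>1. real k \<le> mo_y \<delta> T \<and> a k \<noteq> 0) \<longrightarrow> mo_h \<delta> T a c < 1"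
proof (intro exI[of _ "max 2 (exp (4 * r\<^sup>2 / \<delta> + 1))"] conjI allI impI)
  show "2 \<le> max 2 (exp (4 * r\<^sup>2 / \<delta> + 1))" by simp
next
  fix T :: real and a :: "nat \<Rightarrow> complex"
  assume T: "max 2 (exp (4 * r\<^sup>2 / \<delta> + 1)) \<le> T"
    and ex: "\<exists>k\<ge>1. real k \<le> mo_y \<delta> T \<and> a k \<noteq> 0"
  define L where "L = ln T"
  define y where "y = mo_y \<delta> T"
  define N where "N = nat \<lfloor>y\<rfloor>"
  define p where "p = (\<lambda>n. 1 - \<kappa> * (ln (real n) / L)\<^sup>2)"
  define D where "D = (\<Sum>k=1..N. (cmod (a k))\<^sup>2)"
  define P where "P = {(k, n). k \<ge> 1 \<and> n \<ge> 1 \<and> k * n \<le> N}"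
  define t where "t = (\<lambda>(k, n). a k * cnj (a (k * n)) *
    complex_of_real (mo_g c T n * (mangoldt n / sqrt (real n))))"
  have "T > 1" using T by simp
  have "4 * r\<^sup>2 / \<delta> + 1 \<le> L"
    using T \<open>T > 1\<close> by (simp add: L_def ln_ge_iff)
  then have L: "4 * r\<^sup>2 / \<delta> < L" by simp
  have "0 \<le> 4 * r\<^sup>2 / \<delta>" using \<delta> by simp
  then have "L > 0" using L by linarith
  have "y > 0" and ln_y: "ln y = (1 - \<delta>) * L"
    using \<open>T > 1\<close> by (simp_all add: y_def mo_y_def L_def)
  have le_y_iff: "real m \<le> mo_y \<delta> T \<longleftrightarrow> m \<le> N" for m
    using \<open>y > 0\<close> unfolding N_def y_def[symmetric] by (simp add: le_nat_iff le_floor_iff)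
  have ln_le: "ln (real m) \<le> (1 - \<delta>) * L" if "1 \<le> m" "m \<le> N" for m
  proof -
    have "ln (real m) \<le> ln y"
      using that le_y_iff[of m] \<open>y > 0\<close> by (simp add: y_def)
    then show ?thesis by (simp add: ln_y)
  qed
  have "finite P"
    by (rule finite_subset[of _ "{..N} \<times> {..N}"])
       (auto simp: P_def intro: order_trans[rotated])
  have "D > 0"
  proof -
    obtain k where "k \<ge> 1" "k \<le> N" "a k \<noteq> 0"
      using ex le_y_iff by auto
    then show ?thesis
      unfolding D_def by (intro sum_pos2[of _ k]) auto
  qed
  have term_le: "cmod (t (k, n)) \<le> c / L * (r * ((cmod (a k))\<^sup>2 * (mangoldt n / real n * p n))
      + 1 / r * (mangoldt n * (cmod (a (k * n)))\<^sup>2))" if "(k, n) \<in> P" for k n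
  \<comment> \<open>\<open>mo_g\<close> has ln n in its denominator, so n = 1 is separate; its term
    vanishes because \<open>mangoldt 1 = 0\<close>.\<close>
  proof (cases "n = 1")
    case True
    then show ?thesis by (simp add: t_def)
  next
    case False
    have kn: "1 \<le> k" "1 < n" "k * n \<le> N"
      using that False by (auto simp: P_def)
    then have "n \<le> N"
      by (metis One_nat_def dual_order.trans mult_le_mono1 nat_mult_1)
    define u where "u = ln (real n) / L"
    define q where "q = sin (pi * c * u) / (pi * c * u)"
    \<comment> \<open>All of |q| / sqrt n goes to the k side, where squaring yields the Mertens
      weight; the kn side keeps \<open>mangoldt n\<close> alone, whose divisor sum is exact.\<close>
    define A where "A = cmod (a k) * \<bar>q\<bar> / sqrt (real n)"
    define B where "B = cmod (a (k * n))"
    have "ln (real n) \<le> 1 * L"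
      using ln_le[of n] \<open>n \<le> N\<close> kn \<delta> \<open>L > 0\<close>
      by (intro order_trans[OF ln_le mult_right_mono]) auto
    then have u: "0 < u" "u \<le> 1"
      using kn \<open>L > 0\<close> by (auto simp: u_def)
    have q2: "q\<^sup>2 \<le> p n"
      using sinc[OF u] by (simp add: q_def p_def u_def)
    have g: "mo_g c T n = 2 * c / L * q"
      using \<open>L > 0\<close> kn c by (simp add: mo_g_def q_def u_def L_def[symmetric])
    have "A\<^sup>2 = (cmod (a k))\<^sup>2 * (q\<^sup>2 / real n)"
      by (simp add: A_def power_mult_distrib power_divide)
    also have "\<dots> \<le> (cmod (a k))\<^sup>2 * (p n / real n)"
      using q2 by (intro mult_left_mono divide_right_mono) auto
    finally have A2: "A\<^sup>2 \<le> (cmod (a k))\<^sup>2 * (p n / real n)" .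
    have "0 \<le> (r * A - B)\<^sup>2 / r"
      using r by simp
    also have "\<dots> = r * A\<^sup>2 + 1 / r * B\<^sup>2 - 2 * A * B"
      using r by (simp add: power2_eq_square field_simps)
    finally have "2 * A * B \<le> r * A\<^sup>2 + 1 / r * B\<^sup>2" by simp
    also have "\<dots> \<le> r * ((cmod (a k))\<^sup>2 * (p n / real n)) + 1 / r * B\<^sup>2"
      using A2 r by (intro add_right_mono mult_left_mono) auto
    finally have amgm: "2 * A * B \<le> r * ((cmod (a k))\<^sup>2 * (p n / real n)) + 1 / r * B\<^sup>2" .
    have "cmod (t (k, n)) = c / L * mangoldt n * (2 * A * B)"
      using c \<open>L > 0\<close> mangoldt_nonneg[of n]
      by (simp add: t_def g A_def B_def norm_mult abs_mult norm_divide)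
    also have "\<dots> \<le> c / L * mangoldt n * (r * ((cmod (a k))\<^sup>2 * (p n / real n)) + 1 / r * B\<^sup>2)"
      using c \<open>L > 0\<close> mangoldt_nonneg[of n] by (intro mult_left_mono[OF amgm]) auto
    finally show ?thesis
      by (simp add: B_def algebra_simps)
  qed
  \<comment> \<open>A common bound for the total coefficient of |a_k|^2: 1 - c comes from
    \<open>balance\<close>, the rest is the Mertens error 4 against the gain from \<delta>.\<close>
  define K where "K = 1 - c + c * (4 * r / L - \<delta> / r)"
  \<comment> \<open>The threshold for \<open>T\<close> is chosen for this inequality; the 1 added
    there makes it strict.\<close>
  have "4 * r / L - \<delta> / r < 0"
    using L \<open>L > 0\<close> r \<delta> by (simp add: field_simps power2_eq_square)
  then have "K < 1 - c"
    using c by (simp add: K_def mult_pos_neg)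
  have row_le: "c / L * (r * (\<Sum>n=1..N div k. mangoldt n / real n * p n) + 1 / r * ln (real k)) \<le> K"
    if k: "k \<in> {1..N}" for k
  proof -
    define M where "M = N div k"
    \<comment> \<open>Rounding y / k down to \<open>M\<close> is harmless:
      \<open>k * M \<le> N\<close> still bounds ln k by L (1 - \<delta> - x).\<close>
    define x where "x = ln (real M) / L"
    have M: "1 \<le> M" "k * M \<le> N"
      using k by (auto simp: M_def Suc_le_eq div_greater_zero_iff)
    have "ln (real k) + ln (real M) = ln (real (k * M))"
      using k M by (simp add: ln_mult)
    also have "\<dots> \<le> (1 - \<delta>) * L"
      using k M by (intro ln_le) auto
    finally have lnk: "ln (real k) \<le> L * (1 - \<delta> - x)"
      using \<open>L > 0\<close> by (simp add: x_def algebra_simps)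
    moreover have "0 \<le> ln (real k)" using k by simp
    ultimately have "0 \<le> 1 - \<delta> - x"
      using \<open>L > 0\<close> by (metis order_trans zero_le_mult_iff not_le)
    moreover have "0 \<le> x" using M \<open>L > 0\<close> by (simp add: x_def)
    ultimately have x: "0 \<le> x" "x \<le> 1" using \<delta> by auto
    then have "ln (real M) \<le> L" using \<open>L > 0\<close> by (simp add: x_def)
    then have "(\<Sum>n=1..M. mangoldt n / real n * p n) \<le> L * (x - \<kappa> * x ^ 3 / 3) + 4"
      using weighted_mertens_upper[of \<kappa> L M] \<kappa> \<open>L > 0\<close> M by (simp add: p_def x_def)
    then have "c / L * (r * (\<Sum>n=1..M. mangoldt n / real n * p n) + 1 / r * ln (real k))
        \<le> c / L * (r * (L * (x - \<kappa> * x ^ 3 / 3) + 4) + 1 / r * (L * (1 - \<delta> - x)))"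
      using c r \<open>L > 0\<close> lnk by (intro mult_left_mono add_mono) auto
    also have "\<dots> = c * (r * (x - \<kappa> * x ^ 3 / 3) + (1 - x) / r) + c * (4 * r / L - \<delta> / r)"
      using r \<open>L > 0\<close> by (simp add: field_simps)
    also have "\<dots> \<le> K"
      using balance[OF x] by (simp add: K_def)
    finally show ?thesis by (simp add: M_def)
  qed
  have "- Re (sum t P) \<le> cmod (sum t P)"
    using abs_Re_le_cmod[of "sum t P"] by linarith
  also have "\<dots> \<le> (\<Sum>z\<in>P. cmod (t z))"
    by (rule norm_sum)
  also have "\<dots> \<le> (\<Sum>(k, n)\<in>P. c / L * (r * ((cmod (a k))\<^sup>2 * (mangoldt n / real n * p n))
      + 1 / r * (mangoldt n * (cmod (a (k * n)))\<^sup>2)))"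
    using term_le by (intro sum_mono) auto
  also have "\<dots> = c / L * (r * (\<Sum>(k, n)\<in>P. (cmod (a k))\<^sup>2 * (mangoldt n / real n * p n))
      + 1 / r * (\<Sum>(k, n)\<in>P. mangoldt n * (cmod (a (k * n)))\<^sup>2))"
    by (simp add: sum_distrib_left sum.distrib case_prod_unfold distrib_left)
  \<comment> \<open>The first sum is taken row by row; the second is grouped by the product kn,
    which is then renamed k so that both feed the coefficient of |a_k|^2.\<close>
  also have "\<dots> = (\<Sum>k=1..N. (cmod (a k))\<^sup>2 *
      (c / L * (r * (\<Sum>n=1..N div k. mangoldt n / real n * p n) + 1 / r * ln (real k))))"
    using sum_pairs_first[of "\<lambda>k. (cmod (a k))\<^sup>2" "\<lambda>n. mangoldt n / real n * p n" N]
      sum_pairs_product[of "\<lambda>m. (cmod (a m))\<^sup>2" N]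
    unfolding P_def
    by (simp add: sum_distrib_left sum.distrib[symmetric] algebra_simps)
  also have "\<dots> \<le> (\<Sum>k=1..N. (cmod (a k))\<^sup>2 * K)"
    by (intro sum_mono mult_left_mono row_le) auto
  also have "\<dots> = K * D"
    by (simp add: D_def sum_distrib_left mult.commute)
  also have "\<dots> < (1 - c) * D"
    using \<open>K < 1 - c\<close> \<open>D > 0\<close> by simp
  finally have "- Re (sum t P) / D < 1 - c"
    unfolding pos_divide_less_eq[OF \<open>D > 0\<close>] .
  moreover have "{k. k \<ge> 1 \<and> k \<le> N} = {1..N}" by auto
  then have "mo_h \<delta> T a c = c - Re (sum t P) / D"
    unfolding mo_h_def le_y_iff D_def P_def t_def by simp
  ultimately show "mo_h \<delta> T a c < 1" by simp
qed

theorem theorem1: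
  fixes c \<delta> :: real
  assumes "0 < c" and "c < 0.5042"
    and "0 < \<delta>" and "\<delta> < 1"
  shows "\<exists>T\<^sub>0\<ge>2. \<forall>T\<ge>T\<^sub>0. \<forall>a :: nat \<Rightarrow> complex.
           (\<exists>k\<ge>1. real k \<le> mo_y \<delta> T \<and> a k \<noteq> 0) \<longrightarrow> mo_h \<delta> T a c < 1"
proof (cases "c \<le> 1/2")
  case True
  \<comment> \<open>For r = 1 and \<kappa> = 0 the balance condition collapses to 2c \<le>
    1.\<close>
  show ?thesis
    by (rule mo_h_less_one_criterion[where r = 1 and \<kappa> = 0])
       (use assms True in \<open>auto intro!: sinc_square_le_one\<close>)
next
  case False
  \<comment> \<open>Taking r > 1 cheapens the terms ln m / r, and the decay of q^2 pays for the
    rest: the bracket in \<open>balance\<close> is 1 / 1.1 at x = 0 and 1.1 * 0.81 at x = 1, both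
    below 1.\<close>
  show ?thesis
  proof (rule mo_h_less_one_criterion[where r = "1.1" and \<kappa> = "0.57"])
    fix x :: real
    assume x: "0 \<le> x" "x \<le> 1"
    \<comment> \<open>the tangent to \<open>x\<^sup>3\<close> at \<open>0.55\<close>, which is near the maximum of the left-hand side of the goal\<close>
    have "0 \<le> (x - 0.55)\<^sup>2 * (x + 1.1)"
      using x by simp
    also have "\<dots> = x ^ 3 - 0.9075 * x + 0.33275"
      by (simp add: power2_eq_square power3_eq_cube field_simps)
    finally have "1.1 * (x - 0.57 * x ^ 3 / 3) + (1 - x) / 1.1 \<le> 0.98"
      using x by (simp add: field_simps)
    then have "c * (1.1 * (x - 0.57 * x ^ 3 / 3) + (1 - x) / 1.1) \<le> c * 0.98"
      using assms(1) by (rule mult_left_mono[OF _ less_imp_le])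
    \<comment> \<open>Here the numerical bound on c enters: 1.98 * 0.5042 = 0.998316.\<close>
    moreover have "c + c * 0.98 \<le> 1"
      using assms by simp
    ultimately show "c + c * (1.1 * (x - 0.57 * x ^ 3 / 3) + (1 - x) / 1.1) \<le> 1"
      by (rule order_trans[OF add_left_mono])
  qed (use assms False sinc_square_le[of c] in auto)
qed

end
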